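(* Let a finite group $G$ act on finite nonempty sets $X$ and $Y$, and let $p:X\to Y$ be a uniform stabilizer-preserving $G$-cover of degree $m\ge1$. Then: (a) $X_g=p^{-1}(Y_g)$ and $|X_g|=m|Y_g|$ for every $g\in G$. Hence $G_X^*=G_Y^*$. (b) On this common dual state space, $Q_X=Q_Y$. (c) $K_X(x,x')=m^{-1}K_Y(p(x),p(x'))$ for all $x,x'\in X$. Thus $K_X$ strongly lumps by the fibers of $p$ to $K_Y$ (identifying the fiber $p^{-1}(y)$ with $y$). Moreover, for the orbit-lumped kernels, $$\bar K_X([x],[x'])=\frac1m\bar K_Y([p(x)],[p(x')]).$$ (d) For integers $t\ge1$ and $x\in X$, $$\|K_X^t(x,\cdot)-\pi_{K_X}\|_{\mathrm{TV}}=\|K_Y^t(p(x),\cdot)-\pi_{K_Y}\|_{\mathrm{TV}},\qquad d_{K_X}(t)=d_{K_Y}(t).$$ (e) $\pi_{Q_X}=\pi_{Q_Y}$, and $\pi_{K_X}(x)=m^{-1}\pi_{K_Y}(p(x))$ for all $x\in X$. (f) $\mathrm{Spec}_{\ne0}(K_X)=\mathrm{Spec}_{\ne0}(Q_X)=\mathrm{Spec}_{\ne0}(Q_Y)=\mathrm{Spec}_{\ne0}(K_Y)$, with matching algebraic multiplicities.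
   Context: A map $p:X\to Y$ is a uniform stabilizer-preserving $G$-cover of degree $m\ge1$ if (i) $p(gx)=gp(x)$ for all $g\in G,x\in X$; (ii) $|p^{-1}(y)|=m$ for all $y\in Y$; (iii) $G_x=G_{p(x)}$ for all $x\in X$, where $G_x$ denotes the stabilizer. For an action of $G$ on a finite set $W$ ($W=X$ or $Y$): $W_g:=\{w\in W:gw=w\}$, $G_w:=\{g\in G:gw=w\}$, $G_W^*:=\{g\in G:W_g\ne\varnothing\}$. The classical Burnside kernel on $W$ is $K_W(w,w')=\frac1{|G_w|}\sum_{g\in G_w\cap G_{w'}}\frac1{|W_g|}$ with stationary law $\pi_{K_W}(w)=|G_w|/(|G|\,|W/G|)$. The dual Burnside kernel on $G_W^*$ is $Q_W(g,h)=\frac1{|W_g|}\sum_{w\in W_g\cap W_h}\frac1{|G_w|}$ with stationary law $\pi_{Q_W}(g)=|W_g|/(|G|\,|W/G|)$. The kernel $K_W$ is strongly lumpable by $G$-orbits, and the orbit-lumped kernel is $\bar K_W([w],[w'])=\sum_{u\in[w']}K_W(w,u)$, where $[w]$ is the $G$-orbit of $w$. A kernel $P$ is strongly lumpable by a partition if $\sum_{y\in B}P(x,y)$ depends only on the block containing $x$, for every block $B$; these sums define the lumped kernel. $\|\mu-\nu\|_{\mathrm{TV}}=\frac12\sum_s|\mu(s)-\nu(s)|$, and $d_P(t)=\max_s\|P^t(s,\cdot)-\pi\|_{\mathrm{TV}}$. $\mathrm{Spec}_{\ne0}$ denotes nonzero eigenvalues. *)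

theory Defs
  imports
    "HOL-Algebra.Group_Action"
    "HOL-Library.Disjoint_Sets"
    "HOL-Library.Countable_Set"
    "Jordan_Normal_Form.Spectral_Radius"
begin

section \<open>Kernels on a finite state space\<close>

text \<open>A kernel is a function of two states; its finite state space \<open>S\<close> is always passed
  explicitly, and the values of the function outside \<open>S\<close> are irrelevant.\<close>

fun kernel_pow :: "'a set \<Rightarrow> ('a \<Rightarrow> 'a \<Rightarrow> real) \<Rightarrow> nat \<Rightarrow> 'a \<Rightarrow> 'a \<Rightarrow> real" where
  "kernel_pow S P 0 s s' = (if s = s' then 1 else 0)"
| "kernel_pow S P (Suc t) s s' = (\<Sum>u\<in>S. P s u * kernel_pow S P t u s')"

definition tv_dist :: "'a set \<Rightarrow> ('a \<Rightarrow> real) \<Rightarrow> ('a \<Rightarrow> real) \<Rightarrow> real" where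
  "tv_dist S \<mu> \<nu> = (1/2) * (\<Sum>s\<in>S. \<bar>\<mu> s - \<nu> s\<bar>)"

definition mix_dist :: "'a set \<Rightarrow> ('a \<Rightarrow> 'a \<Rightarrow> real) \<Rightarrow> ('a \<Rightarrow> real) \<Rightarrow> nat \<Rightarrow> real" where
  "mix_dist S P \<pi> t = Max ((\<lambda>s. tv_dist S (kernel_pow S P t s) \<pi>) ` S)"

definition strongly_lumpable :: "'a set \<Rightarrow> ('a \<Rightarrow> 'a \<Rightarrow> real) \<Rightarrow> 'a set set \<Rightarrow> bool" where
  "strongly_lumpable S P \<B> \<longleftrightarrow> partition_on S \<B> \<and>
     (\<forall>A\<in>\<B>. \<forall>B\<in>\<B>. \<forall>x\<in>A. \<forall>x'\<in>A. (\<Sum>y\<in>B. P x y) = (\<Sum>y\<in>B. P x' y))"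

text \<open>The lumped kernel is evaluated at an arbitrary representative of the first block. This is
  meaningful for strongly lumpable kernels, see the lemma below.\<close>

definition lumped_kernel :: "('a \<Rightarrow> 'a \<Rightarrow> real) \<Rightarrow> 'a set \<Rightarrow> 'a set \<Rightarrow> real" where
  "lumped_kernel P A B = (\<Sum>y\<in>B. P (SOME x. x \<in> A) y)"

lemma lumped_kernel_eq:
  assumes "strongly_lumpable S P \<B>" "A \<in> \<B>" "B \<in> \<B>" "x \<in> A"
  shows "lumped_kernel P A B = (\<Sum>y\<in>B. P x y)"
proof -
  have "(SOME x. x \<in> A) \<in> A" using assms(4) by (rule someI)
  then show ?thesis using assms unfolding lumped_kernel_def strongly_lumpable_def by blast
qed

text \<open>Matrices are indexed by numbers, so the state space is enumerated by \<^const>\<open>from_nat_into\<close>;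
  the characteristic polynomial does not depend on the enumeration (lemma below).
  The spectrum is taken over the complex numbers.\<close>

definition kernel_mat :: "'a set \<Rightarrow> ('a \<Rightarrow> 'a \<Rightarrow> real) \<Rightarrow> complex mat" where
  "kernel_mat S P = mat (card S) (card S)
     (\<lambda>(i, j). complex_of_real (P (from_nat_into S i) (from_nat_into S j)))"

definition nonzero_spectrum :: "'a set \<Rightarrow> ('a \<Rightarrow> 'a \<Rightarrow> real) \<Rightarrow> complex set" where
  "nonzero_spectrum S P = spectrum (kernel_mat S P) - {0}"

definition alg_mult :: "'a set \<Rightarrow> ('a \<Rightarrow> 'a \<Rightarrow> real) \<Rightarrow> complex \<Rightarrow> nat" where
  "alg_mult S P c = Polynomial.order c (char_poly (kernel_mat S P))"

lemma char_poly_kernel_mat_enum: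
  assumes fin: "finite S" and e: "bij_betw e {..<card S} S"
  shows "char_poly (kernel_mat S P) =
    char_poly (mat (card S) (card S) (\<lambda>(i, j). complex_of_real (P (e i) (e j))))"
proof -
  define n where "n = card S"
  define f where "f = from_nat_into S"
  have f: "bij_betw f {..<n} S"
    unfolding f_def n_def by (rule bij_betw_from_nat_into_finite[OF fin])
  define q where "q = (\<lambda>i. if i \<in> {0..<n} then inv_into {..<n} f (e i) else i)"
  have "bij_betw (inv_into {..<n} f \<circ> e) {..<n} {..<n}"
    using bij_betw_trans[OF e[folded n_def] bij_betw_inv_into[OF f]] .
  then have "bij_betw q {0..<n} {0..<n}"
    by (subst (asm) bij_betw_cong[where g = q]) (auto simp: q_def atLeast0LessThan)
  then have q: "q permutes {0..<n}"
    by (rule bij_imp_permutes) (auto simp: q_def)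
  have qn: "q i < n" if "i < n" for i
    using permutes_in_image[OF q, of i] that by auto
  have fq: "f (q i) = e i" if "i < n" for i
  proof -
    have "e i \<in> f ` {..<n}" using bij_betwE[OF e] f that by (auto simp: n_def bij_betw_def)
    then show ?thesis using that by (simp add: q_def f_inv_into_f)
  qed
  have q_inj: "q i = q j \<longleftrightarrow> i = j" for i j
    using permutes_inj[OF q] by (auto dest: injD)
  let ?A = "char_poly_matrix (kernel_mat S P)"
  let ?B = "char_poly_matrix (mat n n (\<lambda>(i, j). complex_of_real (P (e i) (e j))))"
  have A: "?A \<in> carrier_mat n n"
    by (rule char_poly_matrix_closed) (simp add: kernel_mat_def n_def)
  let ?R = "mat n n (\<lambda>(i, j). ?A $$ (q i, j))"
  have R: "?R \<in> carrier_mat n n" by simp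
  have B: "transpose_mat ?B = mat n n (\<lambda>(i, j). transpose_mat ?R $$ (q i, j))"
    by (rule eq_matI)
      (auto simp: char_poly_matrix_def kernel_mat_def f_def[symmetric] n_def[symmetric] qn fq q_inj)
  have "det ?B = det (transpose_mat ?B)"
    by (rule det_transpose[symmetric, where n = n]) (simp add: char_poly_matrix_def)
  also have "\<dots> = signof q * det (transpose_mat ?R)"
    unfolding B by (rule det_permute_rows[OF _ q]) simp
  also have "\<dots> = signof q * (signof q * det ?A)"
    using det_transpose[OF R] det_permute_rows[OF A q] by simp
  also have "\<dots> = det ?A"
    by (simp add: sign_def)
  finally show ?thesis by (simp add: char_poly_def n_def)
qed


section \<open>Burnside kernels\<close>

text \<open>Below, \<open>\<phi>\<close> is an action of \<open>G\<close> on \<open>W\<close> in the sense of \<^locale>\<open>group_action\<close>;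
  \<open>W\<^sub>g\<close> is \<^term>\<open>invariants W \<phi> g\<close> and \<open>G\<^sub>w\<close> is \<^term>\<open>stabilizer G \<phi> w\<close>.\<close>

definition dual_states :: "('g, 'b) monoid_scheme \<Rightarrow> 'w set \<Rightarrow> ('g \<Rightarrow> 'w \<Rightarrow> 'w) \<Rightarrow> 'g set" where
  "dual_states G W \<phi> = {g \<in> carrier G. invariants W \<phi> g \<noteq> {}}"

definition burnside_kernel ::
    "('g, 'b) monoid_scheme \<Rightarrow> 'w set \<Rightarrow> ('g \<Rightarrow> 'w \<Rightarrow> 'w) \<Rightarrow> 'w \<Rightarrow> 'w \<Rightarrow> real" where
  "burnside_kernel G W \<phi> w w' =
     1 / real (card (stabilizer G \<phi> w)) *
     (\<Sum>g \<in> stabilizer G \<phi> w \<inter> stabilizer G \<phi> w'. 1 / real (card (invariants W \<phi> g)))"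

definition burnside_stat ::
    "('g, 'b) monoid_scheme \<Rightarrow> 'w set \<Rightarrow> ('g \<Rightarrow> 'w \<Rightarrow> 'w) \<Rightarrow> 'w \<Rightarrow> real" where
  "burnside_stat G W \<phi> w =
     real (card (stabilizer G \<phi> w)) / (real (card (carrier G)) * real (card (orbits G W \<phi>)))"

definition dual_kernel ::
    "('g, 'b) monoid_scheme \<Rightarrow> 'w set \<Rightarrow> ('g \<Rightarrow> 'w \<Rightarrow> 'w) \<Rightarrow> 'g \<Rightarrow> 'g \<Rightarrow> real" where
  "dual_kernel G W \<phi> g h =
     1 / real (card (invariants W \<phi> g)) *
     (\<Sum>w \<in> invariants W \<phi> g \<inter> invariants W \<phi> h. 1 / real (card (stabilizer G \<phi> w)))"

definition dual_stat ::
    "('g, 'b) monoid_scheme \<Rightarrow> 'w set \<Rightarrow> ('g \<Rightarrow> 'w \<Rightarrow> 'w) \<Rightarrow> 'g \<Rightarrow> real" where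
  "dual_stat G W \<phi> g =
     real (card (invariants W \<phi> g)) / (real (card (carrier G)) * real (card (orbits G W \<phi>)))"

definition orbit_kernel ::
    "('g, 'b) monoid_scheme \<Rightarrow> 'w set \<Rightarrow> ('g \<Rightarrow> 'w \<Rightarrow> 'w) \<Rightarrow> 'w set \<Rightarrow> 'w set \<Rightarrow> real" where
  "orbit_kernel G W \<phi> = lumped_kernel (burnside_kernel G W \<phi>)"

definition fiber :: "'x set \<Rightarrow> ('x \<Rightarrow> 'y) \<Rightarrow> 'y \<Rightarrow> 'x set" where
  "fiber X p y = {x \<in> X. p x = y}"

definition uniform_stabilizer_cover ::
    "('g, 'b) monoid_scheme \<Rightarrow> 'x set \<Rightarrow> ('g \<Rightarrow> 'x \<Rightarrow> 'x) \<Rightarrow> 'y set \<Rightarrow> ('g \<Rightarrow> 'y \<Rightarrow> 'y)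
      \<Rightarrow> ('x \<Rightarrow> 'y) \<Rightarrow> nat \<Rightarrow> bool" where
  "uniform_stabilizer_cover G X \<phi> Y \<psi> p m \<longleftrightarrow>
     m \<ge> 1 \<and> p \<in> X \<rightarrow> Y \<and>
     (\<forall>g\<in>carrier G. \<forall>x\<in>X. p (\<phi> g x) = \<psi> g (p x)) \<and>
     (\<forall>y\<in>Y. card (fiber X p y) = m) \<and>
     (\<forall>x\<in>X. stabilizer G \<phi> x = stabilizer G \<psi> (p x))"

context group_action
begin

lemma burnside_kernel_equivariant:
  assumes g: "g \<in> carrier G" and w: "w \<in> E" and u: "u \<in> E"
  shows "burnside_kernel G E \<phi> (\<phi> g w) (\<phi> g u) = burnside_kernel G E \<phi> w u"
proof -
  interpret group G using group_hom by (rule group_hom.axioms)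
  define c where "c = (\<lambda>h. g \<otimes> h \<otimes> inv g)"
  define d where "d = (\<lambda>h. inv g \<otimes> h \<otimes> g)"
  have cC: "c h \<in> carrier G" and dC: "d h \<in> carrier G" and dc: "d (c h) = h" and cd: "c (d h) = h"
    if "h \<in> carrier G" for h
    using that g by (simp_all add: c_def d_def m_assoc inv_solve_left' inv_solve_left)
      (simp_all add: m_assoc[symmetric])
  have act: "\<phi> (c h) (\<phi> g v) = \<phi> g (\<phi> h v)" if "h \<in> carrier G" "v \<in> E" for h v
  proof -
    have "\<phi> (c h) (\<phi> g v) = \<phi> (c h \<otimes> g) v"
      using composition_rule[OF that(2) cC[OF that(1)] g] by simp
    also have "c h \<otimes> g = g \<otimes> h" using that g by (simp add: c_def m_assoc)
    finally show ?thesis using composition_rule[OF that(2) g that(1)] by simp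
  qed
  have inE: "\<phi> k v \<in> E" if "k \<in> carrier G" "v \<in> E" for k v
    using element_image[OF that] by simp
  have st: "c h \<in> stabilizer G \<phi> (\<phi> g v) \<longleftrightarrow> h \<in> stabilizer G \<phi> v"
    if "h \<in> carrier G" "v \<in> E" for h v
    using that inj_onD[OF inj_prop[OF g], of "\<phi> h v" v]
    by (auto simp: stabilizer_def act cC inE)
  have bij: "bij_betw c (stabilizer G \<phi> w) (stabilizer G \<phi> (\<phi> g w))"
    and bij2: "bij_betw c (stabilizer G \<phi> w \<inter> stabilizer G \<phi> u)
        (stabilizer G \<phi> (\<phi> g w) \<inter> stabilizer G \<phi> (\<phi> g u))"
  proof -
    have sub: "\<And>h v. h \<in> stabilizer G \<phi> v \<Longrightarrow> h \<in> carrier G"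
      by (simp add: stabilizer_def)
    have std: "d h \<in> stabilizer G \<phi> v \<longleftrightarrow> h \<in> stabilizer G \<phi> (\<phi> g v)"
      if "h \<in> carrier G" "v \<in> E" for h v
      using st[OF dC[OF that(1)] that(2)] cd[OF that(1)] by simp
    show "bij_betw c (stabilizer G \<phi> w) (stabilizer G \<phi> (\<phi> g w))"
      by (rule bij_betw_byWitness[where f' = d]) (auto simp: dc cd sub st std w)
    show "bij_betw c (stabilizer G \<phi> w \<inter> stabilizer G \<phi> u)
        (stabilizer G \<phi> (\<phi> g w) \<inter> stabilizer G \<phi> (\<phi> g u))"
      by (rule bij_betw_byWitness[where f' = d]) (auto simp: dc cd sub st std w u)
  qed
  have inv: "card (invariants E \<phi> (c h)) = card (invariants E \<phi> h)" if h: "h \<in> carrier G" for h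
  proof (rule bij_betw_same_card[symmetric, where f = "\<phi> g"], unfold bij_betw_def, intro conjI)
    show "inj_on (\<phi> g) (invariants E \<phi> h)"
      by (rule inj_on_subset[OF inj_prop[OF g]]) (auto simp: invariants_def)
    show "\<phi> g ` invariants E \<phi> h = invariants E \<phi> (c h)"
    proof
      show "\<phi> g ` invariants E \<phi> h \<subseteq> invariants E \<phi> (c h)"
        by (auto simp: invariants_def act h inE g)
      show "invariants E \<phi> (c h) \<subseteq> \<phi> g ` invariants E \<phi> h"
      proof
        fix v assume v: "v \<in> invariants E \<phi> (c h)"
        then have "v \<in> E" by (simp add: invariants_def)
        then obtain z where z: "z \<in> E" "v = \<phi> g z" using surj_prop[OF g] by blast
        have "\<phi> g (\<phi> h z) = \<phi> g z" using v z act[OF h z(1)] by (simp add: invariants_def)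
        then have "\<phi> h z = z" using inj_onD[OF inj_prop[OF g]] inE[OF h z(1)] z(1) by blast
        then show "v \<in> \<phi> g ` invariants E \<phi> h" using z by (auto simp: invariants_def)
      qed
    qed
  qed
  show ?thesis
    unfolding burnside_kernel_def bij_betw_same_card[OF bij] sum.reindex_bij_betw[OF bij2, symmetric]
    by (auto intro!: sum.cong arg_cong2[where f = "(*)"] simp: inv stabilizer_def)
qed

lemma strongly_lumpable_orbits:
  "strongly_lumpable E (burnside_kernel G E \<phi>) (orbits G E \<phi>)"
proof -
  interpret group G using group_hom by (rule group_hom.axioms)
  have inE: "\<phi> k v \<in> E" if "k \<in> carrier G" "v \<in> E" for k v
    using element_image[OF that] by simp
  have self: "x \<in> orbit G \<phi> x" if "x \<in> E" for x
    using orbit_refl[OF that] .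
  have part: "partition_on E (orbits G E \<phi>)"
  proof (rule partition_onI)
    show "\<Union> (orbits G E \<phi>) = E" by (rule orbits_coverture)
    show "disjnt A B" if "A \<in> orbits G E \<phi>" "B \<in> orbits G E \<phi>" "A \<noteq> B" for A B
      using disjoint_union[OF that(1,2)] that(3) by (auto simp: disjnt_def)
    show "{} \<notin> orbits G E \<phi>"
      using self by (auto simp: orbits_def)
  qed
  have orb_img: "\<phi> g ` B = B" if g: "g \<in> carrier G" and B: "B \<in> orbits G E \<phi>" for g B
  proof -
    have sub: "\<phi> k ` B \<subseteq> B" if k: "k \<in> carrier G" for k
    proof -
      obtain b where b: "b \<in> E" "B = orbit G \<phi> b" using B by (auto simp: orbits_def)
      show ?thesis
        unfolding b(2) orbit_def
        using composition_rule[OF b(1) k, symmetric] m_closed[OF k] by fastforce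
    qed
    have BE: "B \<subseteq> E" using orbits_coverture B by blast
    have "b \<in> \<phi> g ` B" if b: "b \<in> B" for b
    proof -
      have bE: "b \<in> E" using b BE by blast
      have "\<phi> (inv g) b \<in> B" using sub[OF inv_closed[OF g]] b by blast
      moreover have "\<phi> g (\<phi> (inv g) b) = b"
        using composition_rule[OF bE g inv_closed[OF g]] g bE id_eq_one
        by (metis r_inv restrict_apply)
      ultimately show ?thesis by (metis image_eqI)
    qed
    then show ?thesis using sub[OF g] by blast
  qed
  have "(\<Sum>y\<in>B. burnside_kernel G E \<phi> x y) = (\<Sum>y\<in>B. burnside_kernel G E \<phi> x' y)"
    if A: "A \<in> orbits G E \<phi>" and B: "B \<in> orbits G E \<phi>" and x: "x \<in> A" "x' \<in> A" for A B x x'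
  proof -
    have BE: "B \<subseteq> E" and AE: "A \<subseteq> E" using orbits_coverture A B by blast+
    have key: "(\<Sum>y\<in>B. burnside_kernel G E \<phi> (\<phi> g a) y) = (\<Sum>y\<in>B. burnside_kernel G E \<phi> a y)"
      if g: "g \<in> carrier G" and a: "a \<in> E" for g a
    proof -
      have "(\<Sum>y\<in>\<phi> g ` B. burnside_kernel G E \<phi> (\<phi> g a) y) =
          (\<Sum>y\<in>B. burnside_kernel G E \<phi> (\<phi> g a) (\<phi> g y))"
        by (subst sum.reindex) (auto intro: inj_on_subset[OF inj_prop[OF g] BE])
      also have "\<dots> = (\<Sum>y\<in>B. burnside_kernel G E \<phi> a y)"
        by (rule sum.cong) (use burnside_kernel_equivariant[OF g a] BE in auto)
      finally show ?thesis by (simp add: orb_img[OF g B])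
    qed
    obtain a where a: "a \<in> E" "A = orbit G \<phi> a" using A by (auto simp: orbits_def)
    obtain g g' where "g \<in> carrier G" "x = \<phi> g a" "g' \<in> carrier G" "x' = \<phi> g' a"
      using x unfolding a(2) orbit_def by blast
    then show ?thesis using key a(1) by simp
  qed
  then show ?thesis using part unfolding strongly_lumpable_def by blast
qed

lemma orbit_kernel_eq:
  assumes "w \<in> E" "w' \<in> E"
  shows "orbit_kernel G E \<phi> (orbit G \<phi> w) (orbit G \<phi> w') =
    (\<Sum>u\<in>orbit G \<phi> w'. burnside_kernel G E \<phi> w u)"
  unfolding orbit_kernel_def
  by (rule lumped_kernel_eq[OF strongly_lumpable_orbits])
    (use assms orbit_refl in \<open>auto simp: orbits_def\<close>)

end

end

theory Submission
  imports Defs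
begin

text \<open>Since stabilizers are preserved, a group element fixes a point of \<open>X\<close> iff it fixes its image
  in \<open>Y\<close>, so every sum over \<open>X\<close> in the definitions is \<open>m\<close> times the corresponding sum over \<open>Y\<close>;
  the orbit counts are compared by Burnside's lemma. For the spectra, both Burnside kernels
  factor through the bipartite fixed-point relation as \<open>K = A B\<close> and \<open>Q = B A\<close> with rectangular
  \<open>A\<close> and \<open>B\<close>, and \<open>A B\<close> and \<open>B A\<close> have the same characteristic polynomial up to a power of the
  indeterminate. The kernels \<open>Q\<^sub>X\<close> and \<open>Q\<^sub>Y\<close> coincide and link the two sides.\<close>

section \<open>Spectra of products of rectangular matrices\<close>

text \<open>The block matrix \<open>?M\<close> is reduced in two ways. Multiplication by
  \<open>?R\<close> on the right clears its lower left block and gives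
  \<open>det ?M = det (x I - A B)\<close>. Multiplication by \<open>?L\<close> on the left, with
  \<open>det ?L = x ^ k\<close>, leaves the blocks \<open>x I\<close> and \<open>x I - B A\<close>
  on the diagonal. No division by \<open>x\<close> occurs, so an integral domain suffices.\<close>

lemma det_smult_one_minus_mult_commute:
  fixes x :: "'a :: idom"
  assumes A: "A \<in> carrier_mat n k" and B: "B \<in> carrier_mat k n"
  shows "x ^ k * det (x \<cdot>\<^sub>m 1\<^sub>m n - A * B) = x ^ n * det (x \<cdot>\<^sub>m 1\<^sub>m k - B * A)"
proof -
  let ?M = "four_block_mat (x \<cdot>\<^sub>m 1\<^sub>m n) A B (1\<^sub>m k)"
  let ?R = "four_block_mat (1\<^sub>m n) (0\<^sub>m n k) (- B) (1\<^sub>m k)"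
  let ?L = "four_block_mat (1\<^sub>m n) (0\<^sub>m n k) (- B) (x \<cdot>\<^sub>m 1\<^sub>m k)"
  have M: "?M \<in> carrier_mat (n + k) (n + k)" and R: "?R \<in> carrier_mat (n + k) (n + k)"
    and L: "?L \<in> carrier_mat (n + k) (n + k)"
    by (intro four_block_carrier_mat; simp)+
  have "?M * ?R = four_block_mat (x \<cdot>\<^sub>m 1\<^sub>m n - A * B) A (0\<^sub>m k n) (1\<^sub>m k)"
    using A B
    by (subst mult_four_block_mat[of _ n n _ k _ k]) (auto intro!: cong_four_block_mat eq_matI)
  then have "det (?M * ?R) = det (x \<cdot>\<^sub>m 1\<^sub>m n - A * B)"
    using A B by (simp add: det_four_block_mat_lower_left_zero[of _ n _ k] minus_carrier_mat)
  moreover have "det ?R = 1"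
    using B by (subst det_four_block_mat_upper_right_zero[of _ n _ k]) auto
  ultimately have 1: "det ?M = det (x \<cdot>\<^sub>m 1\<^sub>m n - A * B)"
    by (simp add: det_mult[OF M R])
  have "?L * ?M = four_block_mat (x \<cdot>\<^sub>m 1\<^sub>m n) A (0\<^sub>m k n) (x \<cdot>\<^sub>m 1\<^sub>m k - B * A)"
    using A B
    by (subst mult_four_block_mat[of _ n n _ k _ k]) (auto intro!: cong_four_block_mat eq_matI)
  then have "det (?L * ?M) = x ^ n * det (x \<cdot>\<^sub>m 1\<^sub>m k - B * A)"
    using A B by (simp add: det_four_block_mat_lower_left_zero[of _ n _ k] minus_carrier_mat)
  moreover have "det ?L = x ^ k"
    using B by (subst det_four_block_mat_upper_right_zero[of _ n _ k]) auto
  ultimately show ?thesis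
    using 1 by (simp add: det_mult[OF L M])
qed

text \<open>This is the determinant identity over the polynomial ring, with the indeterminate for
  \<open>x\<close> and the entries of \<open>A\<close> and \<open>B\<close> as constant
  polynomials.\<close>

lemma char_poly_mult_commute:
  fixes A B :: "'a :: idom mat"
  assumes A: "A \<in> carrier_mat n k" and B: "B \<in> carrier_mat k n"
  shows "[:0, 1:] ^ k * char_poly (A * B) = [:0, 1:] ^ n * char_poly (B * A)"
proof -
  let ?c = "map_mat (\<lambda>a::'a. [:a:])"
  have char_poly_eq: "char_poly (C * D) = det ([:0, 1:] \<cdot>\<^sub>m 1\<^sub>m r - ?c C * ?c D)"
    if "C \<in> carrier_mat r s" "D \<in> carrier_mat s r" for C D r s
  proof -
    have "char_poly_matrix (C * D) = [:0, 1:] \<cdot>\<^sub>m 1\<^sub>m r - ?c (C * D)"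
      using that by (intro eq_matI) (auto simp: char_poly_matrix_def)
    then show ?thesis by (simp add: char_poly_def map_poly_mult(1)[OF that])
  qed
  show ?thesis
    unfolding char_poly_eq[OF A B] char_poly_eq[OF B A]
    by (rule det_smult_one_minus_mult_commute) (use A B in auto)
qed

lemma kernel_mat_carrier: "kernel_mat S P \<in> carrier_mat (card S) (card S)"
  by (simp add: kernel_mat_def)

lemma char_poly_kernel_mat_nonzero: "char_poly (kernel_mat S P) \<noteq> 0"
  using degree_monic_char_poly[OF kernel_mat_carrier, of S P] by auto

lemma kernel_mat_cong:
  assumes "\<And>s s'. s \<in> S \<Longrightarrow> s' \<in> S \<Longrightarrow> P s s' = P' s s'"
  shows "kernel_mat S P = kernel_mat S P'"
proof -
  have "from_nat_into S i \<in> S" if "i < card S" for i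
    using that by (intro from_nat_into) auto
  then show ?thesis
    using assms by (auto simp: kernel_mat_def intro!: eq_matI)
qed

text \<open>Eigenvalues are the roots of the characteristic polynomial, which is monic and so
  nonzero. Equality of nonzero spectra thus reduces to equality of multiplicities.\<close>

lemma mem_nonzero_spectrum_iff:
  "c \<in> nonzero_spectrum S P \<longleftrightarrow> c \<noteq> 0 \<and> alg_mult S P c \<noteq> 0"
  using eigenvalue_root_char_poly[OF kernel_mat_carrier, of S P c]
    order_root[of "char_poly (kernel_mat S P)" c]
  by (auto simp: nonzero_spectrum_def alg_mult_def spectrum_def char_poly_kernel_mat_nonzero)

lemma nonzero_spectrum_eqI:
  assumes "\<And>c. c \<noteq> 0 \<Longrightarrow> alg_mult S P c = alg_mult T R c"
  shows "nonzero_spectrum S P = nonzero_spectrum T R"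
  using assms by (auto simp: mem_nonzero_spectrum_iff)

lemma kernel_mat_mult:
  assumes "finite T" and "\<And>s s'. s \<in> S \<Longrightarrow> s' \<in> S \<Longrightarrow> P s s' = (\<Sum>t\<in>T. a s t * b t s')"
  shows "kernel_mat S P =
    mat (card S) (card T) (\<lambda>(i, j). complex_of_real (a (from_nat_into S i) (from_nat_into T j))) *
    mat (card T) (card S) (\<lambda>(i, j). complex_of_real (b (from_nat_into T i) (from_nat_into S j)))"
proof -
  have mem: "from_nat_into S i \<in> S" if "i < card S" for i
    using that by (intro from_nat_into) auto
  have sum_T: "(\<Sum>t\<in>T. f t) = (\<Sum>l = 0..<card T. f (from_nat_into T l))" for f :: "_ \<Rightarrow> real"
    using sum.reindex_bij_betw[OF bij_betw_from_nat_into_finite[OF assms(1)], of f]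
    by (simp add: atLeast0LessThan)
  show ?thesis
    by (rule eq_matI) (auto simp: kernel_mat_def scalar_prod_def assms(2) mem sum_T)
qed

text \<open>The characteristic polynomials agree up to powers of the indeterminate, and those have
  order 0 at every \<open>c\<close> other than 0.\<close>

lemma alg_mult_mult_commute:
  assumes fin: "finite S" "finite T"
    and P: "\<And>s s'. s \<in> S \<Longrightarrow> s' \<in> S \<Longrightarrow> P s s' = (\<Sum>t\<in>T. a s t * b t s')"
    and R: "\<And>t t'. t \<in> T \<Longrightarrow> t' \<in> T \<Longrightarrow> R t t' = (\<Sum>s\<in>S. b t s * a s t')"
    and c: "c \<noteq> 0"
  shows "alg_mult S P c = alg_mult T R c"
proof -
  let ?x = "[:0, 1:] :: complex poly"
  have eq: "?x ^ card T * char_poly (kernel_mat S P) = ?x ^ card S * char_poly (kernel_mat T R)"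
    by (subst kernel_mat_mult[where a = a and b = b, OF fin(2)], rule P, assumption+,
        subst kernel_mat_mult[where a = b and b = a, OF fin(1)], rule R, assumption+)
      (rule char_poly_mult_commute; simp)
  have order_shift: "order c (?x ^ k * q) = order c q" if "q \<noteq> 0" for k q
  proof -
    have "order c (?x ^ k) = 0"
      using c by (intro order_0I) simp
    then show ?thesis
      using that by (subst order_mult) auto
  qed
  show ?thesis
    using arg_cong[OF eq, of "order c"]
    by (simp add: alg_mult_def order_shift char_poly_kernel_mat_nonzero)
qed


section \<open>Duality of the Burnside kernels\<close>

context group_action
begin

lemma invariants_iff_stabilizer:
  "g \<in> carrier G \<Longrightarrow> w \<in> E \<Longrightarrow> w \<in> invariants E \<phi> g \<longleftrightarrow> g \<in> stabilizer G \<phi> w"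
  by (simp add: invariants_def stabilizer_def)

text \<open>The factors are the two half-steps of the Burnside process: \<open>a w\<close> is
  uniform on the stabilizer of \<open>w\<close>, and \<open>b g\<close> is uniform on the fixed
  points of \<open>g\<close>. Composing them in the two orders gives the Burnside kernel and its
  dual.\<close>

lemma alg_mult_burnside_dual:
  assumes fin: "finite (carrier G)" "finite E" and c: "c \<noteq> 0"
  shows "alg_mult E (burnside_kernel G E \<phi>) c = alg_mult (dual_states G E \<phi>) (dual_kernel G E \<phi>) c"
proof -
  let ?D = "dual_states G E \<phi>"
  define a where "a w g = of_bool (g \<in> stabilizer G \<phi> w) / real (card (stabilizer G \<phi> w))" for w g
  define b where "b g w = of_bool (g \<in> stabilizer G \<phi> w) / real (card (invariants E \<phi> g))" for w g
  have finD: "finite ?D"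
    using fin(1) by (simp add: dual_states_def)
  \<comment> \<open>An element of a stabilizer has a fixed point, so summing over \<open>?D\<close>
    alone loses no term of the Burnside kernel.\<close>
  have stab_sub: "stabilizer G \<phi> w \<subseteq> ?D" if "w \<in> E" for w
    using that by (auto simp: dual_states_def stabilizer_def invariants_def)
  show ?thesis
  proof (rule alg_mult_mult_commute[OF fin(2) finD _ _ c, where a = a and b = b])
    fix w w' assume w: "w \<in> E" "w' \<in> E"
    have "(\<Sum>g\<in>?D. a w g * b g w') = (\<Sum>g\<in>stabilizer G \<phi> w \<inter> stabilizer G \<phi> w'. a w g * b g w')"
      using stab_sub w by (intro sum.mono_neutral_right finD) (auto simp: a_def b_def)
    then show "burnside_kernel G E \<phi> w w' = (\<Sum>g\<in>?D. a w g * b g w')"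
      by (simp add: burnside_kernel_def a_def b_def sum_distrib_left)
  next
    fix g h assume "g \<in> ?D" "h \<in> ?D"
    then have g: "g \<in> carrier G" "h \<in> carrier G" by (simp_all add: dual_states_def)
    have "(\<Sum>w\<in>E. b g w * a w h) = (\<Sum>w\<in>invariants E \<phi> g \<inter> invariants E \<phi> h. b g w * a w h)"
      using g by (intro sum.mono_neutral_right fin(2))
        (auto simp: a_def b_def invariants_def stabilizer_def)
    also have "\<dots> = dual_kernel G E \<phi> g h"
      unfolding dual_kernel_def sum_distrib_left
      by (rule sum.cong) (use g in \<open>auto simp: a_def b_def invariants_def stabilizer_def\<close>)
    finally show "dual_kernel G E \<phi> g h = (\<Sum>w\<in>E. b g w * a w h)" ..
  qed
qed

end


section \<open>Uniform stabilizer-preserving covers\<close>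

locale stabilizer_cover =
  X: group_action G X \<phi> + Y: group_action G Y \<psi>
  for G :: "('g, 'b) monoid_scheme"
    and X :: "'x set" and \<phi> :: "'g \<Rightarrow> 'x \<Rightarrow> 'x"
    and Y :: "'y set" and \<psi> :: "'g \<Rightarrow> 'y \<Rightarrow> 'y" +
  fixes p :: "'x \<Rightarrow> 'y" and m :: nat
  assumes finite_G: "finite (carrier G)" and finite_X: "finite X" and finite_Y: "finite Y"
    and cover: "uniform_stabilizer_cover G X \<phi> Y \<psi> p m"
begin

section \<open>Fibers and sums over the cover\<close>

lemma m_pos: "m > 0"
  and p_mem: "x \<in> X \<Longrightarrow> p x \<in> Y"
  and p_equivariant: "g \<in> carrier G \<Longrightarrow> x \<in> X \<Longrightarrow> p (\<phi> g x) = \<psi> g (p x)"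
  and card_fiber: "y \<in> Y \<Longrightarrow> card (fiber X p y) = m"
  and stabilizer_p: "x \<in> X \<Longrightarrow> stabilizer G \<psi> (p x) = stabilizer G \<phi> x"
  using cover by (auto simp: uniform_stabilizer_cover_def)

lemma fiber_nonempty: "y \<in> Y \<Longrightarrow> fiber X p y \<noteq> {}"
  using card_fiber[of y] m_pos by auto

lemma p_image: "p ` X = Y"
  using fiber_nonempty p_mem by (fastforce simp: fiber_def)

text \<open>The sum is grouped by fibers: each has \<open>m\<close> points, and the summand is
  constant on it.\<close>

lemma sum_preimage:
  fixes f :: "'y \<Rightarrow> real"
  assumes "B \<subseteq> Y"
  shows "(\<Sum>x | x \<in> X \<and> p x \<in> B. f (p x)) = real m * (\<Sum>y\<in>B. f y)"
proof -
  have "(\<Sum>x | x \<in> X \<and> p x \<in> B. f (p x)) = (\<Sum>y\<in>B. \<Sum>x | x \<in> {x \<in> X. p x \<in> B} \<and> p x = y. f (p x))"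
    using finite_X finite_subset[OF assms finite_Y]
    by (intro sum.group[symmetric]) auto
  also have "\<dots> = (\<Sum>y\<in>B. \<Sum>x\<in>fiber X p y. f y)"
    by (intro sum.cong) (auto simp: fiber_def)
  also have "\<dots> = real m * (\<Sum>y\<in>B. f y)"
    using assms card_fiber by (simp add: sum_distrib_left subset_iff)
  finally show ?thesis .
qed

lemma sum_X: "(\<Sum>x\<in>X. f (p x)) = real m * (\<Sum>y\<in>Y. f y)" for f :: "'y \<Rightarrow> real"
proof -
  have "{x. x \<in> X \<and> p x \<in> Y} = X" using p_mem by blast
  then show ?thesis using sum_preimage[of Y f] by simp
qed

section \<open>Fixed points and the dual kernel\<close>

lemma invariants_preimage:
  assumes "g \<in> carrier G"
  shows "invariants X \<phi> g = {x \<in> X. p x \<in> invariants Y \<psi> g}"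
proof -
  \<comment> \<open>Either membership says that \<open>g\<close> lies in the stabilizer shared by
    \<open>x\<close> and \<open>p x\<close>.\<close>
  have "x \<in> invariants X \<phi> g \<longleftrightarrow> p x \<in> invariants Y \<psi> g" if "x \<in> X" for x
    using that assms by (simp add: X.invariants_iff_stabilizer Y.invariants_iff_stabilizer
        p_mem stabilizer_p)
  then show ?thesis by (auto simp: invariants_def)
qed

lemma card_invariants:
  assumes "g \<in> carrier G"
  shows "card (invariants X \<phi> g) = m * card (invariants Y \<psi> g)"
proof -
  have "real (card (invariants X \<phi> g)) = real m * real (card (invariants Y \<psi> g))"
    using sum_preimage[of "invariants Y \<psi> g" "\<lambda>_. 1"]
    by (simp add: invariants_preimage[OF assms]) (auto simp: invariants_def)
  then show ?thesis by (metis of_nat_eq_iff of_nat_mult)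
qed

lemma dual_states_eq: "dual_states G X \<phi> = dual_states G Y \<psi>"
proof -
  have "invariants X \<phi> g \<noteq> {} \<longleftrightarrow> invariants Y \<psi> g \<noteq> {}" if "g \<in> carrier G" for g
  proof -
    have "finite (invariants X \<phi> g)" "finite (invariants Y \<psi> g)"
      using finite_X finite_Y by (auto simp: invariants_def)
    then show ?thesis
      using card_invariants[OF that] m_pos by (metis card_eq_0_iff mult_eq_0_iff not_gr_zero)
  qed
  then show ?thesis by (auto simp: dual_states_def)
qed

text \<open>The sum over common fixed points and the normalizing count of fixed points of
  \<open>g\<close> both grow by the factor \<open>m\<close>, which cancels.\<close>

lemma dual_kernel_eq:
  assumes "g \<in> carrier G" "h \<in> carrier G"
  shows "dual_kernel G X \<phi> g h = dual_kernel G Y \<psi> g h"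
proof -
  let ?B = "invariants Y \<psi> g \<inter> invariants Y \<psi> h"
  have "invariants X \<phi> g \<inter> invariants X \<phi> h = {x. x \<in> X \<and> p x \<in> ?B}"
    using assms by (auto simp: invariants_preimage)
  then have "(\<Sum>x\<in>invariants X \<phi> g \<inter> invariants X \<phi> h. 1 / real (card (stabilizer G \<phi> x))) =
      (\<Sum>x | x \<in> X \<and> p x \<in> ?B. 1 / real (card (stabilizer G \<psi> (p x))))"
    by (intro sum.cong) (auto simp: stabilizer_p)
  also have "\<dots> = real m * (\<Sum>y\<in>?B. 1 / real (card (stabilizer G \<psi> y)))"
    by (rule sum_preimage) (auto simp: invariants_def)
  finally show ?thesis
    using m_pos by (simp add: dual_kernel_def card_invariants[OF assms(1)])
qed

section \<open>The Burnside kernel and its lumpings\<close>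

lemma burnside_kernel_eq:
  assumes "x \<in> X" "x' \<in> X"
  shows "burnside_kernel G X \<phi> x x' = 1 / real m * burnside_kernel G Y \<psi> (p x) (p x')"
proof -
  \<comment> \<open>The stabilizers, and hence the index set, are the same for both actions; the
    factor \<open>1 / m\<close> comes only from the fixed-point counts.\<close>
  have "(\<Sum>g\<in>stabilizer G \<phi> x \<inter> stabilizer G \<phi> x'. 1 / real (card (invariants X \<phi> g))) =
      (\<Sum>g\<in>stabilizer G \<phi> x \<inter> stabilizer G \<phi> x'. 1 / real m * (1 / real (card (invariants Y \<psi> g))))"
    by (rule sum.cong) (auto simp: stabilizer_def card_invariants)
  then show ?thesis
    by (simp add: burnside_kernel_def stabilizer_p assms sum_distrib_left mult_ac)
qed

lemma sum_fiber_burnside_kernel: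
  assumes "x \<in> X" "y \<in> Y"
  shows "(\<Sum>x'\<in>fiber X p y. burnside_kernel G X \<phi> x x') = burnside_kernel G Y \<psi> (p x) y"
proof -
  have "(\<Sum>x'\<in>fiber X p y. burnside_kernel G X \<phi> x x') =
      (\<Sum>x'\<in>fiber X p y. 1 / real m * burnside_kernel G Y \<psi> (p x) y)"
    using assms by (intro sum.cong) (auto simp: fiber_def burnside_kernel_eq)
  then show ?thesis using m_pos by (simp add: card_fiber assms)
qed

lemma strongly_lumpable_fibers:
  "strongly_lumpable X (burnside_kernel G X \<phi>) (fiber X p ` Y)"
  unfolding strongly_lumpable_def
proof (intro conjI ballI)
  show "partition_on X (fiber X p ` Y)"
    using fiber_nonempty p_mem
    by (intro partition_onI) (force simp: fiber_def disjnt_def)+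
next
  fix A B x x' assume "A \<in> fiber X p ` Y" "B \<in> fiber X p ` Y" "x \<in> A" "x' \<in> A"
  then show "(\<Sum>u\<in>B. burnside_kernel G X \<phi> x u) = (\<Sum>u\<in>B. burnside_kernel G X \<phi> x' u)"
    by (auto simp: sum_fiber_burnside_kernel) (auto simp: fiber_def sum_fiber_burnside_kernel[unfolded fiber_def])
qed

lemma lumped_kernel_fiber:
  assumes "y \<in> Y" "y' \<in> Y"
  shows "lumped_kernel (burnside_kernel G X \<phi>) (fiber X p y) (fiber X p y') =
    burnside_kernel G Y \<psi> y y'"
proof -
  obtain x where x: "x \<in> fiber X p y" using fiber_nonempty[OF assms(1)] by blast
  then have "x \<in> X" "p x = y" by (auto simp: fiber_def)
  then show ?thesis
    using lumped_kernel_eq[OF strongly_lumpable_fibers _ _ x] assms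
    by (simp add: sum_fiber_burnside_kernel)
qed

text \<open>Injectivity is where stabilizer preservation enters: if \<open>g x\<close> and
  \<open>h x\<close> have the same image, then \<open>inv h * g\<close> fixes \<open>p x\<close>,
  hence fixes \<open>x\<close>.\<close>

lemma bij_betw_orbit:
  assumes x: "x \<in> X"
  shows "bij_betw p (orbit G \<phi> x) (orbit G \<psi> (p x))"
proof (unfold bij_betw_def, intro conjI)
  interpret group G using X.group_hom by (rule group_hom.axioms)
  show "p ` orbit G \<phi> x = orbit G \<psi> (p x)"
    using p_equivariant[OF _ x] by (force simp: orbit_def)
  show "inj_on p (orbit G \<phi> x)"
  proof (rule inj_onI)
    fix u v assume "u \<in> orbit G \<phi> x" "v \<in> orbit G \<phi> x" and eq: "p u = p v"
    then obtain g h where g: "g \<in> carrier G" "u = \<phi> g x" and h: "h \<in> carrier G" "v = \<phi> h x"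
      by (auto simp: orbit_def)
    have "\<psi> (inv\<^bsub>G\<^esub> h \<otimes>\<^bsub>G\<^esub> g) (p x) = p x"
      using eq g h x Y.orbit_sym_aux[OF h(1) p_mem[OF x] refl]
      by (simp add: Y.composition_rule p_mem p_equivariant)
    then have "inv\<^bsub>G\<^esub> h \<otimes>\<^bsub>G\<^esub> g \<in> stabilizer G \<psi> (p x)"
      using g h by (simp add: stabilizer_def)
    then have "\<phi> (inv\<^bsub>G\<^esub> h \<otimes>\<^bsub>G\<^esub> g) x = x"
      by (simp add: stabilizer_p[OF x]) (simp add: stabilizer_def)
    then have "\<phi> (h \<otimes>\<^bsub>G\<^esub> (inv\<^bsub>G\<^esub> h \<otimes>\<^bsub>G\<^esub> g)) x = \<phi> h x"
      using g h x by (simp add: X.composition_rule)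
    then show "u = v"
      using g h by (simp add: m_assoc[symmetric])
  qed
qed

text \<open>An orbit, unlike a fiber, is matched one to one with its image, so the sum brings no
  factor \<open>m\<close> and the \<open>1 / m\<close> of the kernel survives.\<close>

lemma orbit_kernel_eq:
  assumes "x \<in> X" "x' \<in> X"
  shows "orbit_kernel G X \<phi> (orbit G \<phi> x) (orbit G \<phi> x') =
    1 / real m * orbit_kernel G Y \<psi> (orbit G \<psi> (p x)) (orbit G \<psi> (p x'))"
proof -
  have "orbit G \<phi> x' \<subseteq> X"
    using X.element_image assms(2) by (auto simp: orbit_def)
  then have "(\<Sum>u\<in>orbit G \<phi> x'. burnside_kernel G X \<phi> x u) =
      (\<Sum>u\<in>orbit G \<phi> x'. 1 / real m * burnside_kernel G Y \<psi> (p x) (p u))"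
    using assms(1) by (intro sum.cong) (auto simp: burnside_kernel_eq)
  also have "\<dots> = (\<Sum>v\<in>orbit G \<psi> (p x'). 1 / real m * burnside_kernel G Y \<psi> (p x) v)"
    by (rule sum.reindex_bij_betw[OF bij_betw_orbit[OF assms(2)]])
  finally show ?thesis
    by (simp add: X.orbit_kernel_eq Y.orbit_kernel_eq assms p_mem sum_distrib_left)
qed

section \<open>Orbit counts and stationary laws\<close>

lemma card_orbits: "card (orbits G X \<phi>) = m * card (orbits G Y \<psi>)"
proof -
  interpret group G using X.group_hom by (rule group_hom.axioms)
  have "Coset.order G > 0"
    using finite_G by (simp add: order_gt_0_iff_finite)
  \<comment> \<open>Burnside's lemma on both sides, with each fixed-point count scaled by
    \<open>m\<close>.\<close>
  moreover have "card (orbits G X \<phi>) * Coset.order G = m * card (orbits G Y \<psi>) * Coset.order G"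
    using X.burnside[OF finite_G finite_X] Y.burnside[OF finite_G finite_Y]
    by (simp add: card_invariants sum_distrib_left mult.assoc)
  ultimately show ?thesis by simp
qed

lemma burnside_stat_eq:
  "x \<in> X \<Longrightarrow> burnside_stat G X \<phi> x = 1 / real m * burnside_stat G Y \<psi> (p x)"
  by (simp add: burnside_stat_def card_orbits stabilizer_p)

lemma dual_stat_eq: "g \<in> carrier G \<Longrightarrow> dual_stat G X \<phi> g = dual_stat G Y \<psi> g"
  using m_pos by (simp add: dual_stat_def card_orbits card_invariants)

section \<open>Kernel powers and mixing\<close>

text \<open>This fails for \<open>t = 0\<close> unless \<open>m = 1\<close>: the identity kernel separates points of a fiber.\<close>

lemma kernel_pow_eq:
  assumes "x \<in> X" "x' \<in> X"
  shows "kernel_pow X (burnside_kernel G X \<phi>) (Suc t) x x' =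
    1 / real m * kernel_pow Y (burnside_kernel G Y \<psi>) (Suc t) (p x) (p x')"
  using assms(1)
proof (induction t arbitrary: x)
  case 0
  then show ?case
    using assms(2) p_mem
    by (simp add: if_distrib finite_X finite_Y burnside_kernel_eq cong: if_cong)
next
  case (Suc t)
  let ?KX = "burnside_kernel G X \<phi>" and ?KY = "burnside_kernel G Y \<psi>"
  have "kernel_pow X ?KX (Suc (Suc t)) x x' =
      (\<Sum>u\<in>X. 1 / real m * (1 / real m * (?KY (p x) (p u) * kernel_pow Y ?KY (Suc t) (p u) (p x'))))"
    unfolding kernel_pow.simps(2)[of X ?KX "Suc t"]
    by (rule sum.cong[OF refl]) (simp only: burnside_kernel_eq Suc mult_ac)
  also have "\<dots> = 1 / real m * (1 / real m *
      (\<Sum>u\<in>X. ?KY (p x) (p u) * kernel_pow Y ?KY (Suc t) (p u) (p x')))"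
    by (simp only: sum_distrib_left)
  \<comment> \<open>Summing over \<open>X\<close> instead of \<open>Y\<close> contributes a factor
    \<open>m\<close>, which cancels one of the two factors \<open>1 / m\<close>.\<close>
  also have "\<dots> = 1 / real m * kernel_pow Y ?KY (Suc (Suc t)) (p x) (p x')"
    unfolding kernel_pow.simps(2)[of Y ?KY "Suc t"]
    using m_pos by (subst sum_X[where f = "\<lambda>v. ?KY (p x) v * kernel_pow Y ?KY (Suc t) v (p x')"]) simp
  finally show ?case .
qed

text \<open>Each pointwise difference shrinks by \<open>1 / m\<close>, while every point of
  \<open>Y\<close> is counted \<open>m\<close> times.\<close>

lemma tv_dist_eq:
  assumes "t \<ge> 1" "x \<in> X"
  shows "tv_dist X (kernel_pow X (burnside_kernel G X \<phi>) t x) (burnside_stat G X \<phi>) =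
    tv_dist Y (kernel_pow Y (burnside_kernel G Y \<psi>) t (p x)) (burnside_stat G Y \<psi>)"
proof -
  obtain s where t: "t = Suc s" using assms(1) by (cases t) auto
  let ?f = "\<lambda>y. \<bar>kernel_pow Y (burnside_kernel G Y \<psi>) t (p x) y - burnside_stat G Y \<psi> y\<bar>"
  have "(\<Sum>u\<in>X. \<bar>kernel_pow X (burnside_kernel G X \<phi>) t x u - burnside_stat G X \<phi> u\<bar>) =
      (\<Sum>u\<in>X. 1 / real m * ?f (p u))"
  proof (rule sum.cong[OF refl])
    fix u assume u: "u \<in> X"
    show "\<bar>kernel_pow X (burnside_kernel G X \<phi>) t x u - burnside_stat G X \<phi> u\<bar> = 1 / real m * ?f (p u)"
      unfolding t kernel_pow_eq[OF assms(2) u] burnside_stat_eq[OF u] right_diff_distrib[symmetric]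
      by (simp only: abs_mult) simp
  qed
  also have "\<dots> = 1 / real m * (\<Sum>u\<in>X. ?f (p u))"
    by (simp only: sum_distrib_left)
  also have "\<dots> = (\<Sum>y\<in>Y. ?f y)"
    using m_pos by (subst sum_X[where f = ?f]) simp
  finally show ?thesis by (simp add: tv_dist_def)
qed

text \<open>Since \<open>p\<close> is onto, both maxima run over the same set of distances.\<close>

lemma mix_dist_eq:
  assumes "t \<ge> 1"
  shows "mix_dist X (burnside_kernel G X \<phi>) (burnside_stat G X \<phi>) t =
    mix_dist Y (burnside_kernel G Y \<psi>) (burnside_stat G Y \<psi>) t"
  unfolding mix_dist_def p_image[symmetric] image_image
  by (rule arg_cong[where f = Max], rule image_cong[OF refl])
    (simp add: tv_dist_eq[OF assms] p_image)

text \<open>The two state sets are one set with one enumeration, so the matrices themselves are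
  equal; hence \<open>c\<close> may also be 0 here.\<close>

lemma alg_mult_dual_eq:
  "alg_mult (dual_states G X \<phi>) (dual_kernel G X \<phi>) c =
    alg_mult (dual_states G Y \<psi>) (dual_kernel G Y \<psi>) c"
proof -
  have "kernel_mat (dual_states G Y \<psi>) (dual_kernel G X \<phi>) =
      kernel_mat (dual_states G Y \<psi>) (dual_kernel G Y \<psi>)"
    by (intro kernel_mat_cong) (auto simp: dual_states_def dual_kernel_eq)
  then show ?thesis by (simp add: alg_mult_def dual_states_eq)
qed

end


theorem theorem3p44:
  fixes G :: "('g, 'b) monoid_scheme"
    and X :: "'x set" and \<phi> :: "'g \<Rightarrow> 'x \<Rightarrow> 'x"
    and Y :: "'y set" and \<psi> :: "'g \<Rightarrow> 'y \<Rightarrow> 'y"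
    and p :: "'x \<Rightarrow> 'y" and m :: nat
  defines "GX \<equiv> dual_states G X \<phi>" and "GY \<equiv> dual_states G Y \<psi>"
    and "KX \<equiv> burnside_kernel G X \<phi>" and "KY \<equiv> burnside_kernel G Y \<psi>"
    and "QX \<equiv> dual_kernel G X \<phi>" and "QY \<equiv> dual_kernel G Y \<psi>"
    and "piKX \<equiv> burnside_stat G X \<phi>" and "piKY \<equiv> burnside_stat G Y \<psi>"
    and "piQX \<equiv> dual_stat G X \<phi>" and "piQY \<equiv> dual_stat G Y \<psi>"
  assumes "finite (carrier G)"
    and "finite X" and "X \<noteq> {}" and "finite Y" and "Y \<noteq> {}"
    and "group_action G X \<phi>" and "group_action G Y \<psi>"
    and "uniform_stabilizer_cover G X \<phi> Y \<psi> p m"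
  shows "
      \<comment> \<open>(a)\<close>
      ((\<forall>g\<in>carrier G. invariants X \<phi> g = {x \<in> X. p x \<in> invariants Y \<psi> g} \<and>
        card (invariants X \<phi> g) = m * card (invariants Y \<psi> g)) \<and> GX = GY)
      \<and> \<comment> \<open>(b)\<close>
      (\<forall>g\<in>GX. \<forall>h\<in>GX. QX g h = QY g h)
      \<and> \<comment> \<open>(c)\<close>
      ((\<forall>x\<in>X. \<forall>x'\<in>X. KX x x' = 1 / real m * KY (p x) (p x')) \<and>
      strongly_lumpable X KX (fiber X p ` Y) \<and>
      (\<forall>y\<in>Y. \<forall>y'\<in>Y. lumped_kernel KX (fiber X p y) (fiber X p y') = KY y y') \<and>
      (\<forall>x\<in>X. \<forall>x'\<in>X. orbit_kernel G X \<phi> (orbit G \<phi> x) (orbit G \<phi> x') =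
        1 / real m * orbit_kernel G Y \<psi> (orbit G \<psi> (p x)) (orbit G \<psi> (p x'))))
      \<and> \<comment> \<open>(d)\<close>
      (\<forall>t\<ge>1. (\<forall>x\<in>X. tv_dist X (kernel_pow X KX t x) piKX =
          tv_dist Y (kernel_pow Y KY t (p x)) piKY) \<and>
        mix_dist X KX piKX t = mix_dist Y KY piKY t)
      \<and> \<comment> \<open>(e)\<close>
      ((\<forall>g\<in>GX. piQX g = piQY g) \<and> (\<forall>x\<in>X. piKX x = 1 / real m * piKY (p x)))
      \<and> \<comment> \<open>(f)\<close>
      (nonzero_spectrum X KX = nonzero_spectrum GX QX \<and>
      nonzero_spectrum GX QX = nonzero_spectrum GY QY \<and>
      nonzero_spectrum GY QY = nonzero_spectrum Y KY \<and>
      (\<forall>c. c \<noteq> 0 \<longrightarrow> alg_mult X KX c = alg_mult GX QX c \<and>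
         alg_mult GX QX c = alg_mult GY QY c \<and> alg_mult GY QY c = alg_mult Y KY c))"
proof -
  interpret stabilizer_cover G X \<phi> Y \<psi> p m
    using assms by (simp add: stabilizer_cover_def stabilizer_cover_axioms_def)
  note defs = GX_def GY_def KX_def KY_def QX_def QY_def piKX_def piKY_def piQX_def piQY_def
  have GX_carrier: "g \<in> carrier G" if "g \<in> GX" for g
    using that by (simp add: GX_def dual_states_def)
  \<comment> \<open>The four kernels are linked through multiplicities in the order
    \<open>KX\<close>, \<open>QX\<close>, \<open>QY\<close>, \<open>KY\<close>; the equalities of
    spectra are read off from these links.\<close>
  have mult_X: "alg_mult X KX c = alg_mult GX QX c" if "c \<noteq> 0" for c
    unfolding defs by (rule X.alg_mult_burnside_dual[OF finite_G finite_X that])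
  have mult_Y: "alg_mult GY QY c = alg_mult Y KY c" if "c \<noteq> 0" for c
    unfolding defs by (rule Y.alg_mult_burnside_dual[OF finite_G finite_Y that, symmetric])
  have mult_G: "alg_mult GX QX c = alg_mult GY QY c" for c
    unfolding defs by (rule alg_mult_dual_eq)
  show ?thesis
  proof (intro conjI)
    show "\<forall>g\<in>carrier G. invariants X \<phi> g = {x \<in> X. p x \<in> invariants Y \<psi> g} \<and>
        card (invariants X \<phi> g) = m * card (invariants Y \<psi> g)"
      by (simp add: invariants_preimage[symmetric] card_invariants)
    show "GX = GY"
      unfolding defs by (rule dual_states_eq)
    show "\<forall>g\<in>GX. \<forall>h\<in>GX. QX g h = QY g h"
      using GX_carrier by (simp add: QX_def QY_def dual_kernel_eq)
    show "\<forall>x\<in>X. \<forall>x'\<in>X. KX x x' = 1 / real m * KY (p x) (p x')"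
      unfolding KX_def KY_def using burnside_kernel_eq by blast
    show "strongly_lumpable X KX (fiber X p ` Y)"
      unfolding KX_def by (rule strongly_lumpable_fibers)
    show "\<forall>y\<in>Y. \<forall>y'\<in>Y. lumped_kernel KX (fiber X p y) (fiber X p y') = KY y y'"
      unfolding KX_def KY_def using lumped_kernel_fiber by blast
    show "\<forall>x\<in>X. \<forall>x'\<in>X. orbit_kernel G X \<phi> (orbit G \<phi> x) (orbit G \<phi> x') =
        1 / real m * orbit_kernel G Y \<psi> (orbit G \<psi> (p x)) (orbit G \<psi> (p x'))"
      using orbit_kernel_eq by blast
    show "\<forall>t\<ge>1. (\<forall>x\<in>X. tv_dist X (kernel_pow X KX t x) piKX =
          tv_dist Y (kernel_pow Y KY t (p x)) piKY) \<and>
        mix_dist X KX piKX t = mix_dist Y KY piKY t"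
      unfolding KX_def KY_def piKX_def piKY_def using tv_dist_eq mix_dist_eq by blast
    show "\<forall>g\<in>GX. piQX g = piQY g"
      using GX_carrier by (simp add: piQX_def piQY_def dual_stat_eq)
    show "\<forall>x\<in>X. piKX x = 1 / real m * piKY (p x)"
      unfolding piKX_def piKY_def using burnside_stat_eq by blast
    show "nonzero_spectrum X KX = nonzero_spectrum GX QX"
      by (rule nonzero_spectrum_eqI) (rule mult_X)
    show "nonzero_spectrum GX QX = nonzero_spectrum GY QY"
      by (rule nonzero_spectrum_eqI) (rule mult_G)
    show "nonzero_spectrum GY QY = nonzero_spectrum Y KY"
      by (rule nonzero_spectrum_eqI) (rule mult_Y)
    show "\<forall>c. c \<noteq> 0 \<longrightarrow> alg_mult X KX c = alg_mult GX QX c \<and>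
         alg_mult GX QX c = alg_mult GY QY c \<and> alg_mult GY QY c = alg_mult Y KY c"
      using mult_X mult_Y mult_G by blast
  qed
qed

end
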